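(* Let $\Sigma_F=(M,F^2,Fe)$ be a Finslerian mechanical system. The Lagrange equations $$\frac{d}{dt}\frac{\partial F^2}{\partial y^i}-\frac{\partial F^2}{\partial x^i}=F_i(x,y),\qquad y^i=\frac{dx^i}{dt},$$ are equivalent to the second order differential equations $$\frac{d^2x^i}{dt^2}+\gamma^i_{jk}\left(x,\frac{dx}{dt}\right)\frac{dx^j}{dt}\frac{dx^k}{dt}=\frac12F^i\left(x,\frac{dx}{dt}\right),$$ where $\gamma^i_{jk}(x,y)=\frac12 g^{is}\left(\frac{\partial g_{sk}}{\partial x^j}+\frac{\partial g_{js}}{\partial x^k}-\frac{\partial g_{jk}}{\partial x^s}\right)$ are the Christoffel symbols of the metric tensor $g_{ij}(x,y)$ of the Finsler space $F^n=(M,F)$.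
   Context: The summation convention is used. $M$ is a real $n$-dimensional smooth manifold, $(x^i,y^i)$ are the induced coordinates on $TM$, and $\widetilde{TM}$ is $TM$ with the zero section removed. A (possibly semidefinite) Finsler space $F^n=(M,F)$ is given by a function $F:TM\to\mathbb R$, $F\ge 0$, smooth on $\widetilde{TM}$ and continuous on the zero section, positively 1-homogeneous in $y$, such that the metric tensor $g_{ij}=\frac12\frac{\partial^2F^2}{\partial y^i\partial y^j}$ is nonsingular and of constant signature on $\widetilde{TM}$; $(g^{ij})$ is the inverse matrix. A Finslerian mechanical system is a triple $\Sigma_F=(M,F^2,Fe)$, where $F^2$ is the energy of a Finsler space $F^n=(M,F)$ and $Fe=F^i(x,y)\frac{\partial}{\partial y^i}$ is a given vertical vector field on $TM$ (external forces), with $F_i=g_{ij}F^j$. The components $F^i,F_i$ of $Fe$ should not be confused with the function $F$. Curves considered have extensions $(x(t),\dot x(t))$ lying in $\widetilde{TM}$. *)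

theory Defs
  imports "HOL-Analysis.Analysis"
begin

section \<open>Smooth functions\<close>

text \<open>Functions of class \<open>C\<^sup>k\<close>, meant for open sets and finite-dimensional domains. The
  derivative is differentiated further along every fixed direction \<open>v\<close>.\<close>

primrec Ck_on :: "nat \<Rightarrow> ('a::real_normed_vector \<Rightarrow> 'b::real_normed_vector) \<Rightarrow> 'a set \<Rightarrow> bool" where
  "Ck_on 0 f S \<longleftrightarrow> continuous_on S f"
| "Ck_on (Suc k) f S \<longleftrightarrow>
     (\<forall>x\<in>S. f differentiable (at x)) \<and> (\<forall>v. Ck_on k (\<lambda>x. frechet_derivative f (at x) v) S)"

definition smooth_on :: "('a::real_normed_vector \<Rightarrow> 'b::real_normed_vector) \<Rightarrow> 'a set \<Rightarrow> bool" where
  "smooth_on f S \<longleftrightarrow> (\<forall>k. Ck_on k f S)"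

section \<open>Smooth manifolds and the tangent bundle\<close>

text \<open>A chart is a pair of a domain and a coordinate map; the values of the coordinate map
  outside the domain are irrelevant.\<close>

type_synonym ('m, 'e) chart = "'m set \<times> ('m \<Rightarrow> 'e)"

definition chart_inv :: "('m, 'e) chart \<Rightarrow> 'e \<Rightarrow> 'm" where
  "chart_inv c = inv_into (fst c) (snd c)"

definition transition :: "('m, 'e) chart \<Rightarrow> ('m, 'e) chart \<Rightarrow> 'e \<Rightarrow> 'e" where
  "transition c d = snd d \<circ> chart_inv c"

definition smooth_manifold :: "'m topology \<Rightarrow> ('m, 'e::euclidean_space) chart set \<Rightarrow> bool" where
  "smooth_manifold X A \<longleftrightarrow>
     Hausdorff_space X \<and> second_countable X \<and> (\<Union>c\<in>A. fst c) = topspace X \<and>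
     (\<forall>c\<in>A. openin X (fst c) \<and> open (snd c ` fst c) \<and>
        homeomorphic_map (subtopology X (fst c)) (top_of_set (snd c ` fst c)) (snd c)) \<and>
     (\<forall>c\<in>A. \<forall>d\<in>A. smooth_on (transition c d) (snd c ` (fst c \<inter> fst d)))"

text \<open>A tangent vector at \<open>p\<close> is given by its components \<open>v c\<close> in all charts \<open>c\<close> around \<open>p\<close>,
  related by the Jacobians of the transition maps. To make the representation unique,
  \<open>v\<close> is 0 on all other arguments.\<close>

type_synonym ('m, 'e) tvec = "'m \<times> (('m, 'e) chart \<Rightarrow> 'e)"

definition tangent_bundle :: "('m, 'e::euclidean_space) chart set \<Rightarrow> ('m, 'e) tvec set" where
  "tangent_bundle A = {(p, v). p \<in> (\<Union>c\<in>A. fst c) \<and>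
     (\<forall>c\<in>A. \<forall>d\<in>A. p \<in> fst c \<inter> fst d \<longrightarrow>
        v d = frechet_derivative (transition c d) (at (snd c p)) (v c)) \<and>
     (\<forall>c. \<not> (c \<in> A \<and> p \<in> fst c) \<longrightarrow> v c = 0)}"

definition zero_section :: "('m, 'e::euclidean_space) chart set \<Rightarrow> ('m, 'e) tvec set" where
  "zero_section A = {(p, v) \<in> tangent_bundle A. v = (\<lambda>_. 0)}"

definition slit_tangent_bundle :: "('m, 'e::euclidean_space) chart set \<Rightarrow> ('m, 'e) tvec set" where
  "slit_tangent_bundle A = tangent_bundle A - zero_section A"

definition scale_tvec :: "real \<Rightarrow> ('m, 'e::euclidean_space) tvec \<Rightarrow> ('m, 'e) tvec" where
  "scale_tvec r u = (fst u, \<lambda>c. r *\<^sub>R snd u c)"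

text \<open>The chart \<open>(x, y)\<close> of the tangent bundle induced by a chart \<open>x\<close> of the manifold. Since
  these charts form again a set of charts, with model space \<open>'e \<times> 'e\<close>, the construction
  can be iterated: \<open>tangent_bundle (tangent_atlas A)\<close> is the double tangent bundle.\<close>

definition tangent_chart ::
    "('m, 'e::euclidean_space) chart set \<Rightarrow> ('m, 'e) chart \<Rightarrow> (('m, 'e) tvec, 'e \<times> 'e) chart" where
  "tangent_chart A c =
     ({u \<in> tangent_bundle A. fst u \<in> fst c}, \<lambda>u. (snd c (fst u), snd u c))"

definition tangent_atlas ::
    "('m, 'e::euclidean_space) chart set \<Rightarrow> (('m, 'e) tvec, 'e \<times> 'e) chart set" where
  "tangent_atlas A = tangent_chart A ` A"

text \<open>Vertical vector fields on the tangent bundle: sections \<open>u \<mapsto> Z u\<close> of the double tangent bundle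
  whose \<open>\<partial>/\<partial>x\<close>-components vanish in all induced charts. No regularity is imposed.\<close>

definition vertical_vector_field :: "('m, 'e::euclidean_space) chart set \<Rightarrow>
    (('m, 'e) tvec \<Rightarrow> (('m, 'e) tvec, 'e \<times> 'e) tvec) \<Rightarrow> bool" where
  "vertical_vector_field A Z \<longleftrightarrow>
     (\<forall>u\<in>tangent_bundle A. Z u \<in> tangent_bundle (tangent_atlas A) \<and> fst (Z u) = u \<and>
        (\<forall>c\<in>A. fst u \<in> fst c \<longrightarrow> fst (snd (Z u) (tangent_chart A c)) = 0))"

section \<open>Local expressions\<close>

text \<open>Points of the local coordinate space are pairs \<open>z = (x, y)\<close>.\<close>

type_synonym 'n coords = "(real^'n) \<times> (real^'n)"

definition partial_x :: "'n::finite \<Rightarrow> ('n coords \<Rightarrow> real) \<Rightarrow> 'n coords \<Rightarrow> real" where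
  "partial_x i f z = frechet_derivative f (at z) (axis i 1, 0)"

definition partial_y :: "'n::finite \<Rightarrow> ('n coords \<Rightarrow> real) \<Rightarrow> 'n coords \<Rightarrow> real" where
  "partial_y i f z = frechet_derivative f (at z) (0, axis i 1)"

definition local_fun ::
    "('m, real^'n::finite) chart set \<Rightarrow> ('m, real^'n) chart \<Rightarrow> (('m, real^'n) tvec \<Rightarrow> real) \<Rightarrow>
     'n coords \<Rightarrow> real" where
  "local_fun A c f = f \<circ> chart_inv (tangent_chart A c)"

definition local_slit ::
    "('m, real^'n::finite) chart set \<Rightarrow> ('m, real^'n) chart \<Rightarrow> 'n coords set" where
  "local_slit A c =
     snd (tangent_chart A c) ` (fst (tangent_chart A c) \<inter> slit_tangent_bundle A)"

definition energy ::
    "('m, real^'n::finite) chart set \<Rightarrow> (('m, real^'n) tvec \<Rightarrow> real) \<Rightarrow> ('m, real^'n) chart \<Rightarrow>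
     'n coords \<Rightarrow> real" where
  "energy A F c = local_fun A c (\<lambda>u. (F u)\<^sup>2)"

definition metric_tensor ::
    "('m, real^'n::finite) chart set \<Rightarrow> (('m, real^'n) tvec \<Rightarrow> real) \<Rightarrow> ('m, real^'n) chart \<Rightarrow>
     'n coords \<Rightarrow> real^'n^'n" where
  "metric_tensor A F c z = (\<chi> i j. 1/2 * partial_y i (partial_y j (energy A F c)) z)"

definition christoffel ::
    "('m, real^'n::finite) chart set \<Rightarrow> (('m, real^'n) tvec \<Rightarrow> real) \<Rightarrow> ('m, real^'n) chart \<Rightarrow>
     'n \<Rightarrow> 'n \<Rightarrow> 'n \<Rightarrow> 'n coords \<Rightarrow> real" where
  "christoffel A F c i j k z =
     (let g = metric_tensor A F c in
      1/2 * (\<Sum>s\<in>UNIV. matrix_inv (g z) $ i $ s *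
        (partial_x j (\<lambda>w. g w $ s $ k) z + partial_x k (\<lambda>w. g w $ j $ s) z
         - partial_x s (\<lambda>w. g w $ j $ k) z)))"

text \<open>\<open>force_up\<close> and \<open>force_low\<close> are the components \<open>F\<^sup>i\<close> and \<open>F\<^sub>i = g\<^sub>i\<^sub>j F\<^sup>j\<close> of a vertical vector
  field.\<close>

definition force_up ::
    "('m, real^'n::finite) chart set \<Rightarrow>
     (('m, real^'n) tvec \<Rightarrow> (('m, real^'n) tvec, 'n coords) tvec) \<Rightarrow> ('m, real^'n) chart \<Rightarrow>
     'n \<Rightarrow> 'n coords \<Rightarrow> real" where
  "force_up A Fe c i z =
     (let T = tangent_chart A c in snd (snd (Fe (chart_inv T z)) T) $ i)"

definition force_low ::
    "('m, real^'n::finite) chart set \<Rightarrow> (('m, real^'n) tvec \<Rightarrow> real) \<Rightarrow>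
     (('m, real^'n) tvec \<Rightarrow> (('m, real^'n) tvec, 'n coords) tvec) \<Rightarrow> ('m, real^'n) chart \<Rightarrow>
     'n \<Rightarrow> 'n coords \<Rightarrow> real" where
  "force_low A F Fe c i z =
     (\<Sum>j\<in>UNIV. metric_tensor A F c z $ i $ j * force_up A Fe c j z)"

section \<open>Finsler spaces and Finslerian mechanical systems\<close>

text \<open>A symmetric matrix has signature \<open>(p, q)\<close> if it is congruent to a diagonal matrix with
  \<open>p\<close> positive and \<open>q\<close> negative diagonal entries.\<close>

definition has_signature :: "real^'n^'n::finite \<Rightarrow> nat \<Rightarrow> nat \<Rightarrow> bool" where
  "has_signature M p q \<longleftrightarrow> transpose M = M \<and>
     (\<exists>(P::real^'n^'n) d. invertible P \<and> transpose P ** M ** P = (\<chi> i j. if i = j then d i else 0) \<and>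
        card {i. d i > 0} = p \<and> card {i. d i < 0} = q)"

definition finsler_space ::
    "'m topology \<Rightarrow> ('m, real^'n::finite) chart set \<Rightarrow> (('m, real^'n) tvec \<Rightarrow> real) \<Rightarrow> bool" where
  "finsler_space X A F \<longleftrightarrow>
     smooth_manifold X A \<and>
     (\<forall>u\<in>tangent_bundle A. F u \<ge> 0) \<and>
     (\<forall>c\<in>A. smooth_on (local_fun A c F) (local_slit A c)) \<and>
     (\<forall>c\<in>A. \<forall>p\<in>fst c. isCont (local_fun A c F) (snd c p, 0)) \<and>
     (\<forall>u\<in>tangent_bundle A. \<forall>r>0. F (scale_tvec r u) = r * F u) \<and>
     (\<forall>c\<in>A. \<forall>z\<in>local_slit A c. invertible (metric_tensor A F c z)) \<and>
     (\<exists>p q. \<forall>c\<in>A. \<forall>z\<in>local_slit A c. has_signature (metric_tensor A F c z) p q)"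

definition finslerian_mechanical_system ::
    "'m topology \<Rightarrow> ('m, real^'n::finite) chart set \<Rightarrow> (('m, real^'n) tvec \<Rightarrow> real) \<Rightarrow>
     (('m, real^'n) tvec \<Rightarrow> (('m, real^'n) tvec, 'n coords) tvec) \<Rightarrow> bool" where
  "finslerian_mechanical_system X A F Fe \<longleftrightarrow> finsler_space X A F \<and> vertical_vector_field A Fe"

section \<open>Curves\<close>

definition curve_extension ::
    "('m, 'e::euclidean_space) chart set \<Rightarrow> (real \<Rightarrow> 'm) \<Rightarrow> real \<Rightarrow> ('m, 'e) tvec" where
  "curve_extension A \<gamma> t =
     (\<gamma> t, \<lambda>c. if c \<in> A \<and> \<gamma> t \<in> fst c then vector_derivative (snd c \<circ> \<gamma>) (at t) else 0)"

definition regular_C2_curve ::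
    "'m topology \<Rightarrow> ('m, 'e::euclidean_space) chart set \<Rightarrow> real set \<Rightarrow> (real \<Rightarrow> 'm) \<Rightarrow> bool" where
  "regular_C2_curve X A I \<gamma> \<longleftrightarrow>
     open I \<and> is_interval I \<and> continuous_map (top_of_set I) X \<gamma> \<and>
     (\<forall>c\<in>A. Ck_on 2 (snd c \<circ> \<gamma>) {t \<in> I. \<gamma> t \<in> fst c}) \<and>
     (\<forall>t\<in>I. curve_extension A \<gamma> t \<in> slit_tangent_bundle A)"

end

theory Submission
  imports Defs
begin

text \<open>The equivalence already holds at each parameter \<open>t\<close> separately. Write \<open>L = F\<^sup>2\<close> in the induced
  coordinates \<open>(x, y)\<close>. Since \<open>L\<close> is 2-homogeneous in \<open>y\<close>, Euler's theorem, applied to \<open>L\<close> and to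
  the 1-homogeneous functions \<open>\<partial>L/\<partial>y\<^sup>i\<close>, gives
  \<open>\<partial>L/\<partial>y\<^sup>i = 2 g\<^sub>k\<^sub>i y\<^sup>k\<close> and \<open>L = g\<^sub>j\<^sub>k y\<^sup>j y\<^sup>k\<close> on the whole slit bundle
  (\<open>partial_y_eq_hessian\<close>, \<open>eq_hessian_quadratic_form\<close>). Both identities hold on an open set and may
  therefore be differentiated in \<open>x\<close> with \<open>y\<close> fixed, which expresses every \<open>x\<close>-derivative in the
  Lagrange equations by \<open>x\<close>-derivatives of \<open>g\<close>, although \<open>g\<close> depends on \<open>y\<close>. The chain rule
  along the curve then yields, as for a Riemannian metric,
  \<open>d/dt (\<partial>L/\<partial>y\<^sup>i) - \<partial>L/\<partial>x\<^sup>i = 2 g\<^sub>i\<^sub>s a\<^sup>s + (\<partial>\<^sub>j g\<^sub>i\<^sub>k + \<partial>\<^sub>k g\<^sub>j\<^sub>i - \<partial>\<^sub>i g\<^sub>j\<^sub>k) y\<^sup>j y\<^sup>k\<close>,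
  where \<open>a\<close> is the coordinate acceleration (\<open>lagrange_operator_eq\<close>). By the definition of the
  Christoffel symbols the right-hand side is \<open>2 g\<^sub>i\<^sub>s (a\<^sup>s + \<gamma>\<^sup>s\<^sub>j\<^sub>k y\<^sup>j y\<^sup>k)\<close>, the force is \<open>g\<^sub>i\<^sub>s F\<^sup>s\<close>,
  and cancelling the invertible matrix \<open>g\<close> proves the claim
  (\<open>lagrange_iff_geodesic_with_force\<close>).

  The symmetry of \<open>g\<close>, used on the way, is part of its having a signature. The calculus takes place
  on the set of coordinates \<open>(x, y)\<close> of the slit bundle, which has to be open and stable under
  positive scaling of \<open>y\<close>. Tangent vectors are families of components, compatible under changes
  of chart, so this rests on the cocycle identity for the Jacobians of the transition maps
  (\<open>transition_cocycle\<close>, \<open>local_slit_eq\<close>).\<close>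

section \<open>Calculus of smooth functions on open sets\<close>

text \<open>Both the set of derivatives of \<open>f\<close> and the arbitrary value chosen by \<^const>\<open>frechet_derivative\<close>
  where \<open>f\<close> is not differentiable depend only on the germ of \<open>f\<close>.\<close>

lemma frechet_derivative_cong_open:
  assumes "open S" "z \<in> S" "\<And>w. w \<in> S \<Longrightarrow> f w = g w"
  shows "frechet_derivative f (at z) = frechet_derivative g (at z)"
proof -
  have "(f has_derivative D) (at z) \<longleftrightarrow> (g has_derivative D) (at z)" for D
    using assms by (metis has_derivative_transform_within_open)
  then show ?thesis
    unfolding frechet_derivative_def by simp
qed

lemma differentiable_cong_open:
  assumes "open S" "z \<in> S" "\<And>w. w \<in> S \<Longrightarrow> f w = g w" "f differentiable (at z)"
  shows "g differentiable (at z)"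
  using assms unfolding differentiable_def by (metis has_derivative_transform_within_open)

lemma Ck_on_cong_open:
  assumes "open S" "\<And>w. w \<in> S \<Longrightarrow> f w = g w" "Ck_on k f S"
  shows "Ck_on k g S"
  using assms(2,3)
proof (induction k arbitrary: f g)
  case 0
  then show ?case by (simp add: continuous_on_eq)
next
  case (Suc k)
  have "Ck_on k (\<lambda>z. frechet_derivative g (at z) v) S" for v
  proof (rule Suc.IH)
    show "Ck_on k (\<lambda>z. frechet_derivative f (at z) v) S"
      using Suc.prems by simp
    show "frechet_derivative f (at w) v = frechet_derivative g (at w) v" if "w \<in> S" for w
      using frechet_derivative_cong_open[OF assms(1) that Suc.prems(1)] by simp
  qed
  moreover have "\<forall>z\<in>S. g differentiable (at z)"
    using differentiable_cong_open[OF assms(1) _ Suc.prems(1)] Suc.prems(2) by simp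
  ultimately show ?case by simp
qed

lemma Ck_on_Suc_imp: "Ck_on (Suc k) f S \<Longrightarrow> Ck_on k f S"
proof (induction k arbitrary: f)
  case 0
  then show ?case
    by (simp add: continuous_at_imp_continuous_on differentiable_imp_continuous_within)
next
  case (Suc k)
  then show ?case
    using Ck_on.simps(2) by blast
qed

lemma Ck_on_add:
  assumes "open S" "Ck_on k f S" "Ck_on k g S"
  shows "Ck_on k (\<lambda>z. f z + g z) S"
  using assms(2,3)
proof (induction k arbitrary: f g)
  case 0
  then show ?case by (simp add: continuous_on_add)
next
  case (Suc k)
  have diff: "f differentiable (at z)" "g differentiable (at z)" if "z \<in> S" for z
    using Suc.prems that by auto
  have "Ck_on k (\<lambda>z. frechet_derivative (\<lambda>z. f z + g z) (at z) v) S" for v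
  proof (rule Ck_on_cong_open[OF assms(1)])
    show "Ck_on k (\<lambda>z. frechet_derivative f (at z) v + frechet_derivative g (at z) v) S"
      using Suc by simp
    show "frechet_derivative f (at z) v + frechet_derivative g (at z) v =
        frechet_derivative (\<lambda>z. f z + g z) (at z) v" if "z \<in> S" for z
    proof -
      have "((\<lambda>z. f z + g z) has_derivative
          (\<lambda>v. frechet_derivative f (at z) v + frechet_derivative g (at z) v)) (at z)"
        using diff[OF that] by (intro has_derivative_add) (auto simp: frechet_derivative_works)
      then show ?thesis by (metis frechet_derivative_at)
    qed
  qed
  with diff show ?case by simp
qed

lemma Ck_on_mult:
  fixes f g :: "'a::real_normed_vector \<Rightarrow> real"
  assumes "open S" "Ck_on k f S" "Ck_on k g S"
  shows "Ck_on k (\<lambda>z. f z * g z) S"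
  using assms(2,3)
proof (induction k arbitrary: f g)
  case 0
  then show ?case by (simp add: continuous_on_mult)
next
  case (Suc k)
  have diff: "f differentiable (at z)" "g differentiable (at z)" if "z \<in> S" for z
    using Suc.prems that by auto
  have "Ck_on k (\<lambda>z. frechet_derivative (\<lambda>z. f z * g z) (at z) v) S" for v
  proof (rule Ck_on_cong_open[OF assms(1)])
    show "Ck_on k (\<lambda>z. f z * frechet_derivative g (at z) v + frechet_derivative f (at z) v * g z) S"
      using Suc.prems by (intro Ck_on_add[OF assms(1)] Suc.IH) (auto intro: Ck_on_Suc_imp)
    show "f z * frechet_derivative g (at z) v + frechet_derivative f (at z) v * g z =
        frechet_derivative (\<lambda>z. f z * g z) (at z) v" if "z \<in> S" for z
    proof -
      have "((\<lambda>z. f z * g z) has_derivative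
          (\<lambda>v. f z * frechet_derivative g (at z) v + frechet_derivative f (at z) v * g z)) (at z)"
        using diff[OF that] by (intro has_derivative_mult) (auto simp: frechet_derivative_works)
      then show ?thesis by (metis frechet_derivative_at)
    qed
  qed
  with diff show ?case by simp
qed

lemma smooth_on_mult:
  fixes f g :: "'a::real_normed_vector \<Rightarrow> real"
  assumes "open S" "smooth_on f S" "smooth_on g S"
  shows "smooth_on (\<lambda>z. f z * g z) S"
  using assms by (simp add: smooth_on_def Ck_on_mult)

lemma smooth_on_imp_differentiable:
  assumes "smooth_on f S" "z \<in> S"
  shows "f differentiable (at z)"
  using assms unfolding smooth_on_def by (metis Ck_on.simps(2))

lemma smooth_on_frechet_derivative:
  assumes "smooth_on f S"
  shows "smooth_on (\<lambda>z. frechet_derivative f (at z) v) S"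
  using assms unfolding smooth_on_def by (metis Ck_on.simps(2))

lemma smooth_on_partial_y: "smooth_on f S \<Longrightarrow> smooth_on (partial_y i f) S"
  unfolding partial_y_def[abs_def] by (rule smooth_on_frechet_derivative)

lemma frechet_derivative_coords:
  fixes f :: "'n::finite coords \<Rightarrow> real"
  assumes "f differentiable (at z)"
  shows "frechet_derivative f (at z) (u, v) =
    (\<Sum>i\<in>UNIV. u $ i * partial_x i f z) + (\<Sum>i\<in>UNIV. v $ i * partial_y i f z)"
proof -
  interpret D: linear "frechet_derivative f (at z)"
    using assms by (rule linear_frechet_derivative)
  have "(u, v) = (\<Sum>i\<in>UNIV. u $ i *\<^sub>R (axis i 1, 0)) + (\<Sum>i\<in>UNIV. v $ i *\<^sub>R (0, axis i 1))"
    using basis_expansion[of u] basis_expansion[of v]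
    by (simp add: prod_eq_iff fst_sum snd_sum scalar_mult_eq_scaleR)
  then show ?thesis
    by (simp only: D.add D.sum D.scaleR) (simp add: partial_x_def partial_y_def)
qed

section \<open>Euler identities for functions homogeneous along the fibers\<close>

text \<open>Only \<open>y\<close> is rescaled, and only by positive factors, as a Finsler function need not be reversible
  and its fiber derivatives need not extend to \<open>y = 0\<close>.\<close>

definition fiber_cone :: "'n::finite coords set \<Rightarrow> bool" where
  "fiber_cone D \<longleftrightarrow> (\<forall>x y r. (x, y) \<in> D \<longrightarrow> r > 0 \<longrightarrow> (x, r *\<^sub>R y) \<in> D)"

definition fiber_homogeneous :: "nat \<Rightarrow> ('n::finite coords \<Rightarrow> real) \<Rightarrow> 'n coords set \<Rightarrow> bool" where
  "fiber_homogeneous m f D \<longleftrightarrow>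
     (\<forall>x y r. (x, y) \<in> D \<longrightarrow> r > 0 \<longrightarrow> f (x, r *\<^sub>R y) = r ^ m * f (x, y))"

text \<open>Euler's identity: differentiate \<open>r \<mapsto> f (x, r y) = r\<^sup>m f (x, y)\<close> at \<open>r = 1\<close>.\<close>

lemma euler_fiber_homogeneous:
  assumes hom: "fiber_homogeneous m f D" and diff: "f differentiable (at (x, y))"
    and z: "(x, y) \<in> D"
  shows "(\<Sum>k\<in>UNIV. y $ k * partial_y k f (x, y)) = real m * f (x, y)"
proof -
  have ray: "((\<lambda>r::real. (x, r *\<^sub>R y)) has_derivative (\<lambda>h. (0, h *\<^sub>R y))) (at 1)"
    by (auto intro!: derivative_eq_intros)
  have "((\<lambda>r. f (x, r *\<^sub>R y)) has_derivative (\<lambda>h. frechet_derivative f (at (x, y)) (0, h *\<^sub>R y))) (at 1)"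
    using has_derivative_compose[OF ray, of f "frechet_derivative f (at (x, y))"] diff
    by (simp add: frechet_derivative_works)
  moreover have "((\<lambda>r. r ^ m * f (x, y)) has_derivative (\<lambda>h. h * (real m * f (x, y)))) (at 1)"
    by (auto intro!: derivative_eq_intros)
  then have "((\<lambda>r. f (x, r *\<^sub>R y)) has_derivative (\<lambda>h. h * (real m * f (x, y)))) (at 1)"
  proof (rule has_derivative_transform_within_open[where s = "{0<..}"])
    show "r ^ m * f (x, y) = f (x, r *\<^sub>R y)" if "r \<in> {0<..}" for r
      using hom z that by (simp add: fiber_homogeneous_def)
  qed auto
  ultimately have "(\<lambda>h. frechet_derivative f (at (x, y)) (0, h *\<^sub>R y)) = (\<lambda>h. h * (real m * f (x, y)))"
    by (rule has_derivative_unique)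
  from fun_cong[OF this, of 1] show ?thesis
    by (simp add: frechet_derivative_coords[OF diff])
qed

text \<open>Differentiating \<open>f (x, r y) = r\<^bsup>m+1\<^esup> f (x, y)\<close> in \<open>y\<close> produces a factor \<open>r\<close> on the left, which
  cancels against one of the factors on the right.\<close>

lemma fiber_homogeneous_partial_y:
  assumes hom: "fiber_homogeneous (Suc m) f D" and D: "open D" "fiber_cone D"
    and diff: "\<And>z. z \<in> D \<Longrightarrow> f differentiable (at z)"
  shows "fiber_homogeneous m (partial_y i f) D"
  unfolding fiber_homogeneous_def
proof (intro allI impI)
  fix x y :: "real^'a" and r :: real
  assume z: "(x, y) \<in> D" and r: "r > 0"
  have rz: "(x, r *\<^sub>R y) \<in> D"
    using D z r by (simp add: fiber_cone_def)
  let ?D = "frechet_derivative f (at (x, r *\<^sub>R y))" and ?D' = "frechet_derivative f (at (x, y))"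
  have scale: "((\<lambda>z. (fst z, r *\<^sub>R snd z)) has_derivative (\<lambda>h. (fst h, r *\<^sub>R snd h))) (at (x, y))"
    by (auto intro!: derivative_eq_intros)
  have "((\<lambda>z. f (fst z, r *\<^sub>R snd z)) has_derivative (\<lambda>h. ?D (fst h, r *\<^sub>R snd h))) (at (x, y))"
    using has_derivative_compose[OF scale, of f ?D] diff[OF rz]
    by (simp add: frechet_derivative_works)
  moreover have "((\<lambda>z. r ^ Suc m * f z) has_derivative (\<lambda>h. r ^ Suc m * ?D' h)) (at (x, y))"
    using diff[OF z] by (intro has_derivative_mult_right) (simp add: frechet_derivative_works)
  then have "((\<lambda>z. f (fst z, r *\<^sub>R snd z)) has_derivative (\<lambda>h. r ^ Suc m * ?D' h)) (at (x, y))"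
  proof (rule has_derivative_transform_within_open[OF _ D(1) z])
    show "r ^ Suc m * f w = f (fst w, r *\<^sub>R snd w)" if "w \<in> D" for w
      using hom r that by (cases w) (simp add: fiber_homogeneous_def)
  qed
  ultimately have "(\<lambda>h. ?D (fst h, r *\<^sub>R snd h)) = (\<lambda>h. r ^ Suc m * ?D' h)"
    by (rule has_derivative_unique)
  from fun_cong[OF this, of "(0, axis i 1)"]
  have "?D (r *\<^sub>R (0, axis i 1)) = r ^ Suc m * partial_y i f (x, y)"
    by (simp add: partial_y_def)
  then have "r * partial_y i f (x, r *\<^sub>R y) = r ^ Suc m * partial_y i f (x, y)"
    using linear_frechet_derivative[OF diff[OF rz]]
    by (simp only: linear_cmul) (simp add: partial_y_def)
  then show "partial_y i f (x, r *\<^sub>R y) = r ^ m * partial_y i f (x, y)"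
    using r by simp
qed

section \<open>Lagrange equations of a 2-homogeneous Lagrangian\<close>

text \<open>For \<open>L = F\<^sup>2\<close> this is the Finsler metric tensor.\<close>

definition half_fiber_hessian :: "('n::finite coords \<Rightarrow> real) \<Rightarrow> 'n coords \<Rightarrow> real^'n^'n" where
  "half_fiber_hessian L z = (\<chi> i j. 1/2 * partial_y i (partial_y j L) z)"

text \<open>An \<open>x\<close>-derivative treats factors depending on \<open>y\<close> alone as constants. Both Euler expansions below
  are sums of this form, the quadratic one with index pairs as the summation index.\<close>

lemma partial_x_sum_fiber_coord:
  fixes f :: "'k::finite \<Rightarrow> 'n::finite coords \<Rightarrow> real" and q :: "'k \<Rightarrow> real^'n \<Rightarrow> real"
  assumes D: "open D" "(x, y) \<in> D"
    and f: "\<And>k. f k differentiable (at (x, y))"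
    and q: "\<And>k. q k differentiable (at y)"
    and L: "\<And>w. w \<in> D \<Longrightarrow> L w = (\<Sum>k\<in>UNIV. f k w * q k (snd w))"
  shows "partial_x i L (x, y) = (\<Sum>k\<in>UNIV. partial_x i (f k) (x, y) * q k y)"
proof -
  have q': "((\<lambda>w. q k (snd w)) has_derivative (\<lambda>h. frechet_derivative (q k) (at y) (snd h))) (at (x, y))" for k
    using has_derivative_compose[OF has_derivative_snd[OF has_derivative_ident], of "q k" _ "(x, y)" UNIV] q
    by (simp add: frechet_derivative_works)
  have "((\<lambda>w. \<Sum>k\<in>UNIV. f k w * q k (snd w)) has_derivative
     (\<lambda>h. \<Sum>k\<in>UNIV. f k (x, y) * frechet_derivative (q k) (at y) (snd h)
        + frechet_derivative (f k) (at (x, y)) h * q k (snd (x, y)))) (at (x, y))"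
    using f by (intro has_derivative_sum has_derivative_mult q') (auto simp: frechet_derivative_works)
  from frechet_derivative_at[OF this]
  have "frechet_derivative L (at (x, y)) =
     (\<lambda>h. \<Sum>k\<in>UNIV. f k (x, y) * frechet_derivative (q k) (at y) (snd h)
        + frechet_derivative (f k) (at (x, y)) h * q k (snd (x, y)))"
    using frechet_derivative_cong_open[OF D, of L "\<lambda>w. \<Sum>k\<in>UNIV. f k w * q k (snd w)"] L by simp
  then show ?thesis
    using linear_0[OF linear_frechet_derivative[OF q]] by (simp add: partial_x_def)
qed

lemma vec_nth_differentiable: "(\<lambda>v. v $ k) differentiable (at (x :: real^'n::finite))"
  by (rule bounded_linear_imp_differentiable[OF bounded_linear_vec_nth])

context
  fixes L :: "'n::finite coords \<Rightarrow> real" and D :: "'n coords set"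
  assumes open_D: "open D" and cone_D: "fiber_cone D"
    and smooth_L: "smooth_on L D" and hom_L: "fiber_homogeneous 2 L D"
begin

lemma half_fiber_hessian_differentiable:
  assumes "z \<in> D"
  shows "(\<lambda>w. half_fiber_hessian L w $ i $ j) differentiable (at z)"
proof -
  have "partial_y i (partial_y j L) differentiable (at z)"
    using smooth_L assms by (intro smooth_on_imp_differentiable smooth_on_partial_y)
  then show ?thesis
    by (simp add: half_fiber_hessian_def)
qed

text \<open>Euler's identity for the 1-homogeneous function \<open>\<partial>L/\<partial>y\<^sup>i\<close>, whose fiber derivatives are the
  entries of twice the half Hessian.\<close>

lemma partial_y_eq_hessian:
  assumes "z \<in> D"
  shows "partial_y i L z = (\<Sum>k\<in>UNIV. 2 * half_fiber_hessian L z $ k $ i * snd z $ k)"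
proof (cases z)
  case (Pair x y)
  have "fiber_homogeneous 1 (partial_y i L) D"
    using hom_L open_D cone_D smooth_on_imp_differentiable[OF smooth_L]
    by (intro fiber_homogeneous_partial_y) (auto simp: numeral_2_eq_2)
  from euler_fiber_homogeneous[OF this, of x y] show ?thesis
    using smooth_on_imp_differentiable[OF smooth_on_partial_y[OF smooth_L] assms] assms Pair
    by (simp add: half_fiber_hessian_def mult.commute)
qed

text \<open>Euler's identity for \<open>L\<close> itself; its factor 2 cancels the one in the expansion of
  \<open>\<partial>L/\<partial>y\<^sup>k\<close>.\<close>

lemma eq_hessian_quadratic_form:
  assumes "z \<in> D"
  shows "L z = (\<Sum>k\<in>UNIV. \<Sum>j\<in>UNIV. half_fiber_hessian L z $ j $ k * (snd z $ j * snd z $ k))"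
proof (cases z)
  case (Pair x y)
  have "2 * L z = (\<Sum>k\<in>UNIV. y $ k * partial_y k L z)"
    using euler_fiber_homogeneous[OF hom_L, of x y] smooth_on_imp_differentiable[OF smooth_L assms]
      assms Pair by simp
  also have "\<dots> = 2 * (\<Sum>k\<in>UNIV. \<Sum>j\<in>UNIV. half_fiber_hessian L z $ j $ k * (y $ j * y $ k))"
    unfolding partial_y_eq_hessian[OF assms] using Pair by (simp add: sum_distrib_left mult_ac)
  finally show ?thesis using Pair by simp
qed

lemma partial_x_partial_y_eq_hessian:
  assumes z: "(x, y) \<in> D"
  shows "partial_x j (partial_y i L) (x, y) =
    2 * (\<Sum>k\<in>UNIV. partial_x j (\<lambda>w. half_fiber_hessian L w $ k $ i) (x, y) * y $ k)"
proof -
  have "partial_x j (partial_y i L) (x, y) =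
      (\<Sum>k\<in>UNIV. partial_x j (\<lambda>w. half_fiber_hessian L w $ k $ i) (x, y) * (2 * y $ k))"
  proof (rule partial_x_sum_fiber_coord[OF open_D z, where q = "\<lambda>k y. 2 * y $ k"])
    show "(\<lambda>y. 2 * y $ k) differentiable (at y)" for k
      by (intro differentiable_mult vec_nth_differentiable differentiable_const)
    show "partial_y i L w = (\<Sum>k\<in>UNIV. half_fiber_hessian L w $ k $ i * (2 * snd w $ k))"
      if "w \<in> D" for w
      using partial_y_eq_hessian[OF that] by (simp add: mult_ac)
  qed (rule half_fiber_hessian_differentiable[OF z])
  then show ?thesis by (simp add: sum_distrib_left mult_ac)
qed

lemma partial_x_eq_hessian:
  assumes z: "(x, y) \<in> D"
  shows "partial_x i L (x, y) =
    (\<Sum>k\<in>UNIV. \<Sum>j\<in>UNIV. partial_x i (\<lambda>w. half_fiber_hessian L w $ j $ k) (x, y) * (y $ j * y $ k))"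
proof -
  have "partial_x i L (x, y) =
      (\<Sum>(k, j)\<in>UNIV. partial_x i (\<lambda>w. half_fiber_hessian L w $ j $ k) (x, y) * (y $ j * y $ k))"
    unfolding case_prod_unfold
  proof (rule partial_x_sum_fiber_coord[OF open_D z])
    show "(\<lambda>y. y $ snd p * y $ fst p) differentiable (at y)" for p
      by (intro differentiable_mult vec_nth_differentiable)
    show "L w = (\<Sum>p\<in>UNIV. half_fiber_hessian L w $ snd p $ fst p * (snd w $ snd p * snd w $ fst p))"
      if "w \<in> D" for w
      using eq_hessian_quadratic_form[OF that] by (simp add: sum.cartesian_product case_prod_unfold)
  qed (rule half_fiber_hessian_differentiable[OF z])
  then show ?thesis by (simp add: sum.cartesian_product case_prod_unfold)
qed

text \<open>The term \<open>\<partial>\<^sup>2L/\<partial>x\<^sup>j\<partial>y\<^sup>i y\<^sup>j = 2 \<partial>\<^sub>j g\<^sub>i\<^sub>k y\<^sup>j y\<^sup>k\<close> of the chain rule is split into two halves,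
  one of them with \<open>j\<close> and \<open>k\<close> interchanged, since \<open>y\<^sup>j y\<^sup>k\<close> is symmetric. Together with
  \<open>\<partial>L/\<partial>x\<^sup>i\<close> this produces twice the Christoffel symbols of the first kind.\<close>

lemma lagrange_operator_eq:
  fixes x y :: "real \<Rightarrow> real^'n"
  assumes z: "(x t, y t) \<in> D"
    and x: "(x has_vector_derivative y t) (at t)" and y: "(y has_vector_derivative a) (at t)"
    and sym: "\<And>z. z \<in> D \<Longrightarrow> transpose (half_fiber_hessian L z) = half_fiber_hessian L z"
  defines "g \<equiv> half_fiber_hessian L"
  shows "deriv (\<lambda>s. partial_y i L (x s, y s)) t - partial_x i L (x t, y t) =
    2 * (\<Sum>s\<in>UNIV. g (x t, y t) $ i $ s * a $ s) +
    (\<Sum>j\<in>UNIV. \<Sum>k\<in>UNIV. (partial_x j (\<lambda>w. g w $ i $ k) (x t, y t)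
       + partial_x k (\<lambda>w. g w $ j $ i) (x t, y t) - partial_x i (\<lambda>w. g w $ j $ k) (x t, y t))
       * y t $ j * y t $ k)"
proof -
  let ?z = "(x t, y t)"
  have g_sym: "g w $ j $ k = g w $ k $ j" if "w \<in> D" for w j k
    using sym[OF that] unfolding g_def by (metis transpose_def vec_lambda_beta)
  \<comment> \<open>The symmetry holds on an open set, hence passes to the derivatives.\<close>
  have dg_sym: "partial_x l (\<lambda>w. g w $ j $ k) ?z = partial_x l (\<lambda>w. g w $ k $ j) ?z" for l j k
    unfolding partial_x_def
    using frechet_derivative_cong_open[OF open_D z, of "\<lambda>w. g w $ j $ k" "\<lambda>w. g w $ k $ j"] g_sym
    by simp
  have diff: "partial_y i L differentiable (at ?z)"
    using smooth_L z by (intro smooth_on_imp_differentiable smooth_on_partial_y)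
  have "((\<lambda>s. (x s, y s)) has_derivative (\<lambda>h. (h *\<^sub>R y t, h *\<^sub>R a))) (at t)"
    using x y unfolding has_vector_derivative_def by (rule has_derivative_Pair)
  from has_derivative_compose[OF this, of "partial_y i L"] diff
  have "((\<lambda>s. partial_y i L (x s, y s)) has_derivative
      (\<lambda>h. frechet_derivative (partial_y i L) (at ?z) (h *\<^sub>R (y t, a)))) (at t)"
    by (simp add: frechet_derivative_works)
  then have "((\<lambda>s. partial_y i L (x s, y s)) has_field_derivative
      frechet_derivative (partial_y i L) (at ?z) (y t, a)) (at t)"
    unfolding has_field_derivative_def linear_cmul[OF linear_frechet_derivative[OF diff]]
    by (rule has_derivative_eq_rhs) (simp add: fun_eq_iff mult.commute)
  from DERIV_imp_deriv[OF this]
  have "deriv (\<lambda>s. partial_y i L (x s, y s)) t =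
     (\<Sum>j\<in>UNIV. y t $ j * partial_x j (partial_y i L) ?z) + (\<Sum>s\<in>UNIV. a $ s * partial_y s (partial_y i L) ?z)"
    by (simp add: frechet_derivative_coords[OF diff])
  also have "(\<Sum>s\<in>UNIV. a $ s * partial_y s (partial_y i L) ?z) = 2 * (\<Sum>s\<in>UNIV. g ?z $ i $ s * a $ s)"
    unfolding g_sym[OF z, of i] by (simp add: g_def half_fiber_hessian_def sum_distrib_left mult_ac)
  also have "(\<Sum>j\<in>UNIV. y t $ j * partial_x j (partial_y i L) ?z) =
      2 * (\<Sum>j\<in>UNIV. \<Sum>k\<in>UNIV. partial_x j (\<lambda>w. g w $ i $ k) ?z * y t $ j * y t $ k)"
    unfolding partial_x_partial_y_eq_hessian[OF z] g_def[symmetric] dg_sym[of _ i]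
    by (simp add: sum_distrib_left mult_ac)
  also have "\<dots> = (\<Sum>j\<in>UNIV. \<Sum>k\<in>UNIV. partial_x j (\<lambda>w. g w $ i $ k) ?z * y t $ j * y t $ k)
      + (\<Sum>j\<in>UNIV. \<Sum>k\<in>UNIV. partial_x k (\<lambda>w. g w $ j $ i) ?z * y t $ j * y t $ k)"
    (is "2 * ?S = ?S + ?S'")
  proof -
    have "?S = ?S'"
      by (subst sum.swap) (simp add: dg_sym[of _ i] mult_ac)
    then show ?thesis by simp
  qed
  finally show ?thesis
    unfolding partial_x_eq_hessian[OF z] g_def[symmetric]
    by (subst (2) dg_sym) (simp add: algebra_simps sum.distrib sum_subtractf)
qed

end

section \<open>Induced coordinates on the slit tangent bundle\<close>

context
  fixes X :: "'m topology" and A :: "('m, 'e::euclidean_space) chart set"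
  assumes mfd: "smooth_manifold X A"
begin

lemma chart_domain_openin: "c \<in> A \<Longrightarrow> openin X (fst c)"
  using mfd by (simp add: smooth_manifold_def)

lemma chart_homeomorphic_map:
  "c \<in> A \<Longrightarrow> homeomorphic_map (subtopology X (fst c)) (top_of_set (snd c ` fst c)) (snd c)"
  using mfd by (simp add: smooth_manifold_def)

lemma chart_image_open: "c \<in> A \<Longrightarrow> open (snd c ` fst c)"
  using mfd by (simp add: smooth_manifold_def)

lemma chart_inj_on:
  assumes "c \<in> A"
  shows "inj_on (snd c) (fst c)"
  using homeomorphic_imp_injective_map[OF chart_homeomorphic_map[OF assms]]
    openin_subset[OF chart_domain_openin[OF assms]]
  by (simp add: inf_absorb2)

text \<open>Because chart overlaps have open images, identities between transition maps can be differentiated.\<close>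

lemma chart_overlap_image_open:
  assumes "c \<in> A" "d \<in> A"
  shows "open (snd c ` (fst c \<inter> fst d))"
proof -
  have "openin (subtopology X (fst c)) (fst c \<inter> fst d)"
    using chart_domain_openin[OF assms(2)] by (metis inf_commute openin_subtopology_Int)
  then have "openin (top_of_set (snd c ` fst c)) (snd c ` (fst c \<inter> fst d))"
    using homeomorphic_imp_open_map[OF chart_homeomorphic_map[OF assms(1)]]
    by (simp add: open_map_def)
  then show ?thesis
    using chart_image_open[OF assms(1)] openin_open_trans by blast
qed

lemma transition_eq:
  assumes "c \<in> A" "p \<in> fst c"
  shows "transition c d (snd c p) = snd d p"
  using chart_inj_on[OF assms(1)] assms(2) by (simp add: transition_def chart_inv_def)

lemma transition_differentiable:
  assumes "c \<in> A" "d \<in> A" "p \<in> fst c" "p \<in> fst d"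
  shows "transition c d differentiable (at (snd c p))"
proof (rule smooth_on_imp_differentiable)
  show "smooth_on (transition c d) (snd c ` (fst c \<inter> fst d))"
    using mfd assms by (simp add: smooth_manifold_def)
qed (use assms in auto)

text \<open>The chain rule for \<open>transition c e = transition d e \<circ> transition c d\<close>, which holds near
  \<open>snd c p\<close>.\<close>

lemma transition_cocycle:
  assumes "c \<in> A" "d \<in> A" "e \<in> A" "p \<in> fst c" "p \<in> fst d" "p \<in> fst e"
  shows "frechet_derivative (transition c e) (at (snd c p)) v =
    frechet_derivative (transition d e) (at (snd d p))
      (frechet_derivative (transition c d) (at (snd c p)) v)"
proof -
  have "frechet_derivative (transition c e) (at (snd c p)) =
      frechet_derivative (transition d e \<circ> transition c d) (at (snd c p))"
    by (rule frechet_derivative_cong_open[OF chart_overlap_image_open[of c d]])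
      (use assms in \<open>auto simp: transition_eq\<close>)
  also have "\<dots> = frechet_derivative (transition d e) (at (snd d p)) \<circ>
      frechet_derivative (transition c d) (at (snd c p))"
    using assms by (subst frechet_derivative_compose)
      (auto simp: transition_eq transition_differentiable)
  finally show ?thesis by simp
qed

lemma frechet_derivative_transition_self:
  assumes "c \<in> A" "p \<in> fst c"
  shows "frechet_derivative (transition c c) (at (snd c p)) v = v"
proof -
  have "frechet_derivative (transition c c) (at (snd c p)) = frechet_derivative (\<lambda>x. x) (at (snd c p))"
    by (rule frechet_derivative_cong_open[OF chart_image_open[of c]])
      (use assms in \<open>auto simp: transition_eq\<close>)
  then show ?thesis by simp
qed

lemma tangent_bundle_iff:
  "(p, v) \<in> tangent_bundle A \<longleftrightarrow> p \<in> (\<Union>c\<in>A. fst c) \<and>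
     (\<forall>c\<in>A. \<forall>d\<in>A. p \<in> fst c \<inter> fst d \<longrightarrow>
        v d = frechet_derivative (transition c d) (at (snd c p)) (v c)) \<and>
     (\<forall>c. \<not> (c \<in> A \<and> p \<in> fst c) \<longrightarrow> v c = 0)"
  unfolding tangent_bundle_def mem_Collect_eq case_prod_conv ..

lemma tvec_component:
  assumes "(p, v) \<in> tangent_bundle A" "c \<in> A" "d \<in> A" "p \<in> fst c" "p \<in> fst d"
  shows "v d = frechet_derivative (transition c d) (at (snd c p)) (v c)"
  using assms unfolding tangent_bundle_iff by blast

lemma tvec_component_outside:
  assumes "(p, v) \<in> tangent_bundle A" "\<not> (d \<in> A \<and> p \<in> fst d)"
  shows "v d = 0"
  using assms unfolding tangent_bundle_iff by blast

lemma tangent_bundleI: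
  assumes "p \<in> (\<Union>c\<in>A. fst c)"
    and "\<And>c d. \<lbrakk>c \<in> A; d \<in> A; p \<in> fst c; p \<in> fst d\<rbrakk> \<Longrightarrow>
      v d = frechet_derivative (transition c d) (at (snd c p)) (v c)"
    and "\<And>d. \<not> (d \<in> A \<and> p \<in> fst d) \<Longrightarrow> v d = 0"
  shows "(p, v) \<in> tangent_bundle A"
  using assms unfolding tangent_bundle_iff by blast

text \<open>The components in all other charts around \<open>p\<close> are images of the one in \<open>c\<close> under the Jacobians, and
  the remaining ones are 0.\<close>

lemma tvec_eqI:
  assumes "(p, v) \<in> tangent_bundle A" "(p, w) \<in> tangent_bundle A" "c \<in> A" "p \<in> fst c" "v c = w c"
  shows "v = w"
proof
  fix d
  show "v d = w d"
  proof (cases "d \<in> A \<and> p \<in> fst d")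
    case True
    then show ?thesis
      using tvec_component[OF assms(1,3) _ assms(4)] tvec_component[OF assms(2,3) _ assms(4)] assms(5)
      by metis
  next
    case False
    then show ?thesis
      using tvec_component_outside[OF assms(1)] tvec_component_outside[OF assms(2)] by simp
  qed
qed

text \<open>Every coordinate vector \<open>y\<close> in a chart comes from a tangent vector: transport \<open>y\<close> to the other
  charts by the Jacobians. The cocycle identity makes the resulting family compatible.\<close>

lemma exists_tvec:
  fixes y :: 'e
  assumes "c \<in> A" "p \<in> fst c"
  obtains v where "(p, v) \<in> tangent_bundle A" "v c = y"
proof
  let ?v = "\<lambda>d. if d \<in> A \<and> p \<in> fst d then frechet_derivative (transition c d) (at (snd c p)) y else 0"
  show "(p, ?v) \<in> tangent_bundle A"
  proof (rule tangent_bundleI)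
    show "p \<in> (\<Union>c\<in>A. fst c)" using assms by blast
    show "?v e = frechet_derivative (transition d e) (at (snd d p)) (?v d)"
      if "d \<in> A" "e \<in> A" "p \<in> fst d" "p \<in> fst e" for d e
      using transition_cocycle[OF assms(1) that(1,2) assms(2) that(3,4)] that by simp
    show "?v d = 0" if "\<not> (d \<in> A \<and> p \<in> fst d)" for d
      using that by (rule if_not_P)
  qed
  show "?v c = y"
    using assms by (simp add: frechet_derivative_transition_self)
qed

lemma scale_tvec_in_tangent_bundle:
  assumes "u \<in> tangent_bundle A"
  shows "scale_tvec r u \<in> tangent_bundle A"
proof (cases u)
  case (Pair p v)
  with assms have v: "(p, v) \<in> tangent_bundle A" by simp
  have "(p, \<lambda>c. r *\<^sub>R v c) \<in> tangent_bundle A"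
  proof (rule tangent_bundleI)
    show "p \<in> (\<Union>c\<in>A. fst c)"
      using v unfolding tangent_bundle_iff by blast
    show "r *\<^sub>R v d = frechet_derivative (transition c d) (at (snd c p)) (r *\<^sub>R v c)"
      if "c \<in> A" "d \<in> A" "p \<in> fst c" "p \<in> fst d" for c d
      unfolding linear_cmul[OF linear_frechet_derivative[OF transition_differentiable[OF that]]]
        tvec_component[OF v that] ..
    show "r *\<^sub>R v d = 0" if "\<not> (d \<in> A \<and> p \<in> fst d)" for d
      using tvec_component_outside[OF v that] by simp
  qed
  with Pair show ?thesis by (simp add: scale_tvec_def)
qed

lemma zero_tvec_in_tangent_bundle: "u \<in> tangent_bundle A \<Longrightarrow> (fst u, \<lambda>_. 0) \<in> tangent_bundle A"
  using scale_tvec_in_tangent_bundle[of u 0] by (simp add: scale_tvec_def)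

text \<open>Jacobians are linear, so components that vanish in one chart vanish in all of them.\<close>

lemma slit_tangent_bundle_iff:
  assumes "(p, v) \<in> tangent_bundle A" "c \<in> A" "p \<in> fst c"
  shows "(p, v) \<in> slit_tangent_bundle A \<longleftrightarrow> v c \<noteq> 0"
  using tvec_eqI[OF assms(1) zero_tvec_in_tangent_bundle[OF assms(1), simplified] assms(2,3)] assms(1)
  by (auto simp: slit_tangent_bundle_def zero_section_def)

text \<open>Local expressions of functions on the bundle are formed with \<^const>\<open>chart_inv\<close>, an inverse by
  choice; it is the expected one because induced charts are injective.\<close>

lemma tangent_chart_inv:
  assumes "u \<in> tangent_bundle A" "c \<in> A" "fst u \<in> fst c"
  shows "chart_inv (tangent_chart A c) (snd c (fst u), snd u c) = u"
proof -
  have "inj_on (snd (tangent_chart A c)) (fst (tangent_chart A c))"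
  proof (rule inj_onI)
    fix u w
    assume *: "u \<in> fst (tangent_chart A c)" "w \<in> fst (tangent_chart A c)"
      "snd (tangent_chart A c) u = snd (tangent_chart A c) w"
    then have "fst u = fst w"
      using chart_inj_on[OF assms(2)] by (auto simp: tangent_chart_def dest: inj_onD)
    moreover have "snd u = snd w"
    proof (rule tvec_eqI[OF _ _ assms(2)])
      show "(fst u, snd u) \<in> tangent_bundle A" "fst u \<in> fst c" "snd u c = snd w c"
        using * by (simp_all add: tangent_chart_def)
      show "(fst u, snd w) \<in> tangent_bundle A"
        unfolding \<open>fst u = fst w\<close> using * by (simp add: tangent_chart_def)
    qed
    ultimately show "u = w" by (simp add: prod_eq_iff)
  qed
  then have "chart_inv (tangent_chart A c) (snd (tangent_chart A c) u) = u"
    using assms unfolding chart_inv_def by (intro inv_into_f_f) (auto simp: tangent_chart_def)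
  then show ?thesis by (simp add: tangent_chart_def)
qed

end

text \<open>The coordinate image of the slit bundle is all of the chart image times the nonzero vectors.
  Openness and stability under positive scaling, on which the calculus in coordinates relies, can be
  read off from this product form.\<close>

lemma local_slit_eq:
  fixes A :: "('m, real^'n::finite) chart set"
  assumes "smooth_manifold X A" "c \<in> A"
  shows "local_slit A c = (snd c ` fst c) \<times> (- {0})"
proof (intro subset_antisym subsetI)
  fix z :: "'n coords"
  assume "z \<in> local_slit A c"
  then obtain p v where "(p, v) \<in> slit_tangent_bundle A" "p \<in> fst c" "z = (snd c p, v c)"
    by (auto simp: local_slit_def tangent_chart_def)
  moreover from this have "(p, v) \<in> tangent_bundle A"
    by (simp add: slit_tangent_bundle_def)
  ultimately show "z \<in> (snd c ` fst c) \<times> (- {0})"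
    using slit_tangent_bundle_iff[OF assms(1) _ assms(2)] by auto
next
  fix z :: "'n coords"
  assume "z \<in> (snd c ` fst c) \<times> (- {0})"
  then obtain p y where p: "p \<in> fst c" "z = (snd c p, y)" "y \<noteq> 0"
    by auto
  obtain v where v: "(p, v) \<in> tangent_bundle A" "v c = y"
    using exists_tvec[OF assms p(1)] .
  with p have "(p, v) \<in> slit_tangent_bundle A"
    using slit_tangent_bundle_iff[OF assms(1) v(1) assms(2)] by simp
  with p v show "z \<in> local_slit A c"
    unfolding local_slit_def tangent_chart_def by force
qed

lemma local_slit_open:
  fixes A :: "('m, real^'n::finite) chart set"
  assumes "smooth_manifold X A" "c \<in> A"
  shows "open (local_slit A c)"
  unfolding local_slit_eq[OF assms] by (intro open_Times chart_image_open[OF assms]) auto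

lemma local_slit_fiber_cone:
  fixes A :: "('m, real^'n::finite) chart set"
  assumes "smooth_manifold X A" "c \<in> A"
  shows "fiber_cone (local_slit A c)"
  by (auto simp: fiber_cone_def local_slit_eq[OF assms])

section \<open>The energy of a Finsler space\<close>

context
  fixes X :: "'m topology" and A :: "('m, real^'n::finite) chart set"
    and F :: "('m, real^'n) tvec \<Rightarrow> real" and c :: "('m, real^'n) chart"
  assumes finsler: "finsler_space X A F" and c: "c \<in> A"
begin

lemma finsler_manifold: "smooth_manifold X A"
  using finsler by (simp add: finsler_space_def)

lemma energy_smooth: "smooth_on (energy A F c) (local_slit A c)"
proof -
  have "smooth_on (local_fun A c F) (local_slit A c)"
    using finsler c by (simp add: finsler_space_def)
  moreover have "energy A F c = (\<lambda>z. local_fun A c F z * local_fun A c F z)"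
    by (auto simp: energy_def local_fun_def power2_eq_square)
  ultimately show ?thesis
    using smooth_on_mult[OF local_slit_open[OF finsler_manifold c]] by simp
qed

text \<open>Homogeneity of \<open>F\<close> is a statement about tangent vectors. It carries over to coordinates because
  the vector with coordinates \<open>(x, r y)\<close> is \<open>r\<close> times the one with coordinates \<open>(x, y)\<close>.\<close>

lemma energy_fiber_homogeneous: "fiber_homogeneous 2 (energy A F c) (local_slit A c)"
  unfolding fiber_homogeneous_def
proof (intro allI impI)
  fix x y :: "real^'n" and r :: real
  assume "(x, y) \<in> local_slit A c" and r: "r > 0"
  then obtain p where p: "p \<in> fst c" "x = snd c p"
    by (auto simp: local_slit_eq[OF finsler_manifold c])
  obtain v where v: "(p, v) \<in> tangent_bundle A" "v c = y"
    using exists_tvec[OF finsler_manifold c p(1)] .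
  have "chart_inv (tangent_chart A c) (x, r *\<^sub>R y) = scale_tvec r (p, v)"
    using tangent_chart_inv[OF finsler_manifold scale_tvec_in_tangent_bundle[OF finsler_manifold v(1)] c, of r]
      p v(2) by (simp add: scale_tvec_def)
  moreover have "chart_inv (tangent_chart A c) (x, y) = (p, v)"
    using tangent_chart_inv[OF finsler_manifold v(1) c] p v(2) by simp
  moreover have "F (scale_tvec r (p, v)) = r * F (p, v)"
    using finsler v(1) r by (simp add: finsler_space_def)
  ultimately show "energy A F c (x, r *\<^sub>R y) = r ^ 2 * energy A F c (x, y)"
    by (simp add: energy_def local_fun_def power_mult_distrib)
qed

lemma metric_tensor_eq_half_fiber_hessian: "metric_tensor A F c = half_fiber_hessian (energy A F c)"
  by (simp add: fun_eq_iff metric_tensor_def half_fiber_hessian_def)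

lemma metric_tensor_symmetric:
  "z \<in> local_slit A c \<Longrightarrow> transpose (metric_tensor A F c z) = metric_tensor A F c z"
  using finsler c unfolding finsler_space_def has_signature_def by blast

lemma metric_tensor_invertible: "z \<in> local_slit A c \<Longrightarrow> invertible (metric_tensor A F c z)"
  using finsler c by (simp add: finsler_space_def)

text \<open>Lowering the upper index of the Christoffel symbols undoes the multiplication by \<open>g\<^sup>-\<^sup>1\<close> in their
  definition.\<close>

lemma metric_tensor_christoffel:
  assumes "z \<in> local_slit A c"
  shows "2 * (\<Sum>s\<in>UNIV. metric_tensor A F c z $ i $ s * christoffel A F c s j k z) =
    partial_x j (\<lambda>w. metric_tensor A F c w $ i $ k) z + partial_x k (\<lambda>w. metric_tensor A F c w $ j $ i) z
      - partial_x i (\<lambda>w. metric_tensor A F c w $ j $ k) z"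
proof -
  let ?g = "metric_tensor A F c"
  define b :: "real^'n" where "b = (\<chi> s. partial_x j (\<lambda>w. ?g w $ s $ k) z
    + partial_x k (\<lambda>w. ?g w $ j $ s) z - partial_x s (\<lambda>w. ?g w $ j $ k) z)"
  have christoffel: "2 * christoffel A F c s j k z = (matrix_inv (?g z) *v b) $ s" for s
    by (simp add: christoffel_def Let_def matrix_vector_mult_def b_def)
  have "?g z ** matrix_inv (?g z) = mat 1"
    using metric_tensor_invertible[OF assms] unfolding invertible_def matrix_inv_def
    by (rule someI2_ex) simp
  then have inv: "?g z *v (matrix_inv (?g z) *v b) = b"
    by (simp add: matrix_vector_mul_assoc)
  have "2 * (\<Sum>s\<in>UNIV. ?g z $ i $ s * christoffel A F c s j k z) = (?g z *v (matrix_inv (?g z) *v b)) $ i"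
    unfolding matrix_vector_mult_def[of "?g z"] christoffel[symmetric]
    by (simp add: sum_distrib_left mult_ac)
  also have "\<dots> = b $ i"
    by (simp add: inv)
  finally show ?thesis by (simp add: b_def)
qed

text \<open>The Lagrange equations at \<open>t\<close> read \<open>g (2 (a + spray)) = g f\<close> for the coordinate vectors of
  acceleration, Christoffel term and force; \<open>g\<close> is injective.\<close>

lemma lagrange_iff_geodesic_with_force:
  fixes x y :: "real \<Rightarrow> real^'n"
  assumes z: "(x t, y t) \<in> local_slit A c"
    and x: "(x has_vector_derivative y t) (at t)" and y: "(y has_vector_derivative a) (at t)"
  shows "(\<forall>i. deriv (\<lambda>s. partial_y i (energy A F c) (x s, y s)) t
        - partial_x i (energy A F c) (x t, y t) = force_low A F Fe c i (x t, y t))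
    \<longleftrightarrow> (\<forall>i. a $ i
        + (\<Sum>j\<in>UNIV. \<Sum>k\<in>UNIV. christoffel A F c i j k (x t, y t) * (y t $ j) * (y t $ k))
        = 1/2 * force_up A Fe c i (x t, y t))"
proof -
  let ?g = "metric_tensor A F c (x t, y t)"
  define spray :: "real^'n" where
    "spray = (\<chi> i. \<Sum>j\<in>UNIV. \<Sum>k\<in>UNIV. christoffel A F c i j k (x t, y t) * (y t $ j) * (y t $ k))"
  define f :: "real^'n" where "f = (\<chi> i. force_up A Fe c i (x t, y t))"
  have spray: "2 * (?g *v spray) $ i = (\<Sum>j\<in>UNIV. \<Sum>k\<in>UNIV. (partial_x j (\<lambda>w. metric_tensor A F c w $ i $ k) (x t, y t)
       + partial_x k (\<lambda>w. metric_tensor A F c w $ j $ i) (x t, y t)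
       - partial_x i (\<lambda>w. metric_tensor A F c w $ j $ k) (x t, y t)) * y t $ j * y t $ k)" for i
  proof -
    have "2 * (?g *v spray) $ i = (\<Sum>s\<in>UNIV. \<Sum>j\<in>UNIV. \<Sum>k\<in>UNIV.
        2 * (?g $ i $ s * christoffel A F c s j k (x t, y t)) * y t $ j * y t $ k)"
      by (simp add: matrix_vector_mult_def spray_def sum_distrib_left mult_ac)
    also have "\<dots> = (\<Sum>j\<in>UNIV. \<Sum>k\<in>UNIV. \<Sum>s\<in>UNIV.
        2 * (?g $ i $ s * christoffel A F c s j k (x t, y t)) * y t $ j * y t $ k)"
      by (subst sum.swap) (rule sum.cong[OF refl sum.swap])
    also have "\<dots> = (\<Sum>j\<in>UNIV. \<Sum>k\<in>UNIV.
        2 * (\<Sum>s\<in>UNIV. ?g $ i $ s * christoffel A F c s j k (x t, y t)) * y t $ j * y t $ k)"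
      by (simp add: sum_distrib_left sum_distrib_right)
    finally show ?thesis
      by (simp only: metric_tensor_christoffel[OF z])
  qed
  have "deriv (\<lambda>s. partial_y i (energy A F c) (x s, y s)) t - partial_x i (energy A F c) (x t, y t) =
      (?g *v (2 *\<^sub>R (a + spray))) $ i" for i
    using lagrange_operator_eq[OF local_slit_open[OF finsler_manifold c]
        local_slit_fiber_cone[OF finsler_manifold c] energy_smooth energy_fiber_homogeneous z x y]
      metric_tensor_symmetric spray[of i]
    unfolding metric_tensor_eq_half_fiber_hessian[symmetric]
    by (simp add: matrix_vector_mult_scaleR matrix_vector_right_distrib matrix_vector_mult_def[of _ a])
  moreover have "force_low A F Fe c i (x t, y t) = (?g *v f) $ i" for i
    by (simp add: force_low_def matrix_vector_mult_def f_def)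
  ultimately have "(\<forall>i. deriv (\<lambda>s. partial_y i (energy A F c) (x s, y s)) t
        - partial_x i (energy A F c) (x t, y t) = force_low A F Fe c i (x t, y t))
      \<longleftrightarrow> ?g *v (2 *\<^sub>R (a + spray)) = ?g *v f"
    by (simp add: vec_eq_iff)
  also have "\<dots> \<longleftrightarrow> 2 *\<^sub>R (a + spray) = f"
    using inj_matrix_vector_mult[OF metric_tensor_invertible[OF z]] by (auto dest: injD)
  also have "\<dots> \<longleftrightarrow> (\<forall>i. a $ i + spray $ i = 1/2 * f $ i)"
    by (auto simp: vec_eq_iff field_simps)
  finally show ?thesis by (simp add: spray_def f_def)
qed

end

section \<open>The Lagrange equations along a curve\<close>

text \<open>The second derivative is available for \<open>frechet_derivative x (at s) 1\<close>; near \<open>t\<close> this agrees with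
  the velocity, while outside \<open>U\<close> the two may differ by their default values.\<close>

lemma C2_imp_vector_derivatives:
  fixes x :: "real \<Rightarrow> 'a::real_normed_vector"
  assumes "open U" "Ck_on 2 x U" "t \<in> U"
  shows "(x has_vector_derivative vector_derivative x (at t)) (at t)"
    and "((\<lambda>s. vector_derivative x (at s)) has_vector_derivative
      vector_derivative (\<lambda>s. vector_derivative x (at s)) (at t)) (at t)"
proof -
  have diff: "x differentiable (at s)" if "s \<in> U" for s
    using assms(2) that by (simp add: numeral_2_eq_2)
  then show "(x has_vector_derivative vector_derivative x (at t)) (at t)"
    using assms(3) by (simp add: vector_derivative_works[symmetric])
  have "(\<lambda>s. frechet_derivative x (at s) 1) differentiable (at t)"
    using assms(2,3) by (simp add: numeral_2_eq_2)
  then have "(\<lambda>s. vector_derivative x (at s)) differentiable (at t)"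
    using differentiable_cong_open[OF assms(1,3), of "\<lambda>s. frechet_derivative x (at s) 1"
        "\<lambda>s. vector_derivative x (at s)"] diff
    by (simp add: frechet_derivative_eq_vector_derivative)
  then show "((\<lambda>s. vector_derivative x (at s)) has_vector_derivative
      vector_derivative (\<lambda>s. vector_derivative x (at s)) (at t)) (at t)"
    by (simp add: vector_derivative_works[symmetric])
qed

text \<open>The parameters at which the curve lies in the chart form an open set \<open>U\<close> containing \<open>J\<close>. On \<open>U\<close>
  the coordinate velocity is the genuine derivative of the coordinates and is itself differentiable,
  so the equivalence at a single parameter applies at every \<open>t \<in> J\<close>.\<close>

theorem theorem2p2p1:
  fixes X :: "'m topology"
    and A :: "('m, real^'n::finite) chart set"
    and F :: "('m, real^'n) tvec \<Rightarrow> real"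
    and Fe :: "('m, real^'n) tvec \<Rightarrow> (('m, real^'n) tvec, 'n coords) tvec"
    and c :: "('m, real^'n) chart"
    and \<gamma> :: "real \<Rightarrow> 'm"
    and I J :: "real set"
  assumes "finslerian_mechanical_system X A F Fe"
    and "c \<in> A"
    and "regular_C2_curve X A I \<gamma>"
    and "J \<subseteq> I" and "\<gamma> ` J \<subseteq> fst c"
  shows "let x = (\<lambda>t. snd c (\<gamma> t)); y = (\<lambda>t. vector_derivative x (at t)) in
    (\<forall>t\<in>J. \<forall>i. deriv (\<lambda>s. partial_y i (energy A F c) (x s, y s)) t
        - partial_x i (energy A F c) (x t, y t) = force_low A F Fe c i (x t, y t))
    \<longleftrightarrow>
    (\<forall>t\<in>J. \<forall>i. deriv (deriv (\<lambda>s. x s $ i)) t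
        + (\<Sum>j\<in>UNIV. \<Sum>k\<in>UNIV. christoffel A F c i j k (x t, y t) * (y t $ j) * (y t $ k))
        = 1/2 * force_up A Fe c i (x t, y t))"
proof -
  have finsler: "finsler_space X A F"
    using assms(1) by (simp add: finslerian_mechanical_system_def)
  note mfd = finsler_manifold[OF finsler assms(2)]
  define x where "x = (\<lambda>t. snd c (\<gamma> t))"
  define y where "y = (\<lambda>t. vector_derivative x (at t))"
  define U where "U = {t \<in> I. \<gamma> t \<in> fst c}"
  have "openin (top_of_set I) U"
    using assms(3) openin_continuous_map_preimage[of "top_of_set I" X \<gamma>] chart_domain_openin[OF mfd assms(2)]
    by (simp add: regular_C2_curve_def U_def)
  then have U: "open U"
    using assms(3) openin_open_trans unfolding regular_C2_curve_def by blast
  have C2: "Ck_on 2 x U"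
    using assms(2,3) by (simp add: regular_C2_curve_def x_def U_def comp_def)
  have x': "(x has_vector_derivative y t) (at t)"
    and y': "(y has_vector_derivative vector_derivative y (at t)) (at t)" if "t \<in> U" for t
    using C2_imp_vector_derivatives[OF U C2 that] by (simp_all add: y_def)
  have comp: "((\<lambda>s. w s $ i) has_field_derivative a $ i) (at t)"
    if "(w has_vector_derivative a) (at t)" for w :: "real \<Rightarrow> real^'n" and a t i
    using bounded_linear.has_vector_derivative[OF bounded_linear_vec_nth that]
    by (simp add: has_real_derivative_iff_has_vector_derivative)
  have accel: "deriv (deriv (\<lambda>s. x s $ i)) t = vector_derivative y (at t) $ i" if "t \<in> U" for i t
  proof -
    have "((\<lambda>s. y s $ i) has_field_derivative vector_derivative y (at t) $ i) (at t)"
      using comp[OF y'[OF that]] .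
    then have "(deriv (\<lambda>s. x s $ i) has_field_derivative vector_derivative y (at t) $ i) (at t)"
      by (rule has_field_derivative_transform_within_open[OF _ U that])
        (rule DERIV_imp_deriv[OF comp[OF x'], symmetric])
    then show ?thesis by (rule DERIV_imp_deriv)
  qed
  have slit: "(x t, y t) \<in> local_slit A c" if "t \<in> U" for t
  proof -
    have "curve_extension A \<gamma> t \<in> slit_tangent_bundle A"
      using assms(3) that by (simp add: regular_C2_curve_def U_def)
    moreover have "snd (tangent_chart A c) (curve_extension A \<gamma> t) = (x t, y t)"
      using that assms(2) by (simp add: tangent_chart_def curve_extension_def x_def y_def U_def comp_def)
    moreover have "curve_extension A \<gamma> t \<in> fst (tangent_chart A c)"
      using calculation(1) that
      by (simp add: tangent_chart_def curve_extension_def U_def slit_tangent_bundle_def)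
    ultimately show ?thesis
      unfolding local_slit_def by (metis IntI imageI)
  qed
  have "J \<subseteq> U"
    using assms(4,5) by (auto simp: U_def)
  then have "(\<forall>t\<in>J. \<forall>i. deriv (\<lambda>s. partial_y i (energy A F c) (x s, y s)) t
        - partial_x i (energy A F c) (x t, y t) = force_low A F Fe c i (x t, y t))
    \<longleftrightarrow>
    (\<forall>t\<in>J. \<forall>i. deriv (deriv (\<lambda>s. x s $ i)) t
        + (\<Sum>j\<in>UNIV. \<Sum>k\<in>UNIV. christoffel A F c i j k (x t, y t) * (y t $ j) * (y t $ k))
        = 1/2 * force_up A Fe c i (x t, y t))"
    using lagrange_iff_geodesic_with_force[OF finsler assms(2) slit x' y'] accel
    by (intro ball_cong[OF refl]) (auto simp: subset_iff)
  then show ?thesis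
    unfolding Let_def x_def y_def .
qed

end
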